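(* Let $n\ge 4$ be an even integer and $d=n/2$. Let $\hat C=\begin{pmatrix}0&1\\1&0\end{pmatrix}\otimes J_d\in\mathbb{R}^{n\times n}$. Then $$\mathrm{SDPOPT}(\hat C)\le \frac{\pi^2}{2n}\,\mathrm{TSPOPT}(\hat C).$$
   Context: $J_m$ and $I_m$ denote the $m\times m$ all-ones and identity matrices, $\otimes$ the Kronecker product, and $A\succeq 0$ that the symmetric matrix $A$ is positive semidefinite. For $n$ even, $d=n/2$, and a symmetric cost matrix $C\in\mathbb{R}^{n\times n}$ with zero diagonal, the SDP (of de Klerk, Pasechnik and Sotirov) is: minimize $\frac12\operatorname{tr}(CX^{(1)})$ over real symmetric $n\times n$ matrices $X^{(1)},\dots,X^{(d)}$ subject to $X^{(k)}\ge 0$ entrywise for $k=1,\dots,d$; $\sum_{j=1}^d X^{(j)}=J_n-I_n$; and $I_n+\sum_{j=1}^d\cos\!\left(\frac{2\pi jk}{n}\right)X^{(j)}\succeq 0$ for $k=1,\dots,d$. $\mathrm{SDPOPT}(C)$ is its optimal value. $\mathrm{TSPOPT}(C)$ is the minimum, over Hamiltonian cycles $H$ of the complete graph $K_n$ on vertex set $\{1,\dots,n\}$, of $\sum_{\{i,j\}\in H}C_{ij}$. *)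

theory Defs
  imports Complex_Main "Jordan_Normal_Form.Matrix"
begin

definition all_ones_mat :: "nat \<Rightarrow> real mat"  (\<open>J\<^sub>m\<close>)
  where "J\<^sub>m m = mat m m (\<lambda>_. 1)"

definition kronecker_mat :: "real mat \<Rightarrow> real mat \<Rightarrow> real mat"  (infixl \<open>\<otimes>\<^sub>m\<close> 70)
  where "A \<otimes>\<^sub>m B = mat (dim_row A * dim_row B) (dim_col A * dim_col B)
    (\<lambda>(i, j). A $$ (i div dim_row B, j div dim_col B) * B $$ (i mod dim_row B, j mod dim_col B))"

definition trace_mat :: "real mat \<Rightarrow> real"
  where "trace_mat A = (\<Sum>i<dim_row A. A $$ (i, i))"

definition symmetric_mat :: "real mat \<Rightarrow> bool"
  where "symmetric_mat A \<longleftrightarrow> transpose_mat A = A"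

definition psd_mat :: "real mat \<Rightarrow> bool"
  where "psd_mat A \<longleftrightarrow> symmetric_mat A \<and> (\<forall>v \<in> carrier_vec (dim_row A). 0 \<le> v \<bullet> (A *\<^sub>v v))"

text \<open>The order on matrices is the entrywise one. A point of the SDP is a family
  \<open>X\<close> of which only the members \<open>X 1, \<dots>, X (n div 2)\<close> are relevant.\<close>

definition sdp_feasible :: "nat \<Rightarrow> (nat \<Rightarrow> real mat) set"
  where "sdp_feasible n = {X.
    (\<forall>k \<in> {1..n div 2}. X k \<in> carrier_mat n n \<and> symmetric_mat (X k) \<and> 0\<^sub>m n n \<le> X k) \<and>
    (\<Oplus>\<^bsub>module_mat TYPE(real) n n\<^esub> j \<in> {1..n div 2}. X j) = J\<^sub>m n - 1\<^sub>m n \<and>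
    (\<forall>k \<in> {1..n div 2}. psd_mat (1\<^sub>m n +
      (\<Oplus>\<^bsub>module_mat TYPE(real) n n\<^esub> j \<in> {1..n div 2}.
        cos (2 * pi * real j * real k / real n) \<cdot>\<^sub>m X j)))}"

definition sdp_opt :: "real mat \<Rightarrow> real"
  where "sdp_opt C = (INF X \<in> sdp_feasible (dim_row C). 1 / 2 * trace_mat (C * X 1))"

text \<open>Hamiltonian cycles of the complete graph on \<open>{0..<n}\<close> as sets of edges, an edge
  being a two-element set of vertices; meant for \<open>n \<ge> 3\<close>.\<close>

definition hamiltonian_cycles :: "nat \<Rightarrow> nat set set set"
  where "hamiltonian_cycles n =
    {(\<lambda>i. {p i, p (Suc i mod n)}) ` {0..<n} | p. bij_betw p {0..<n} {0..<n}}"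

text \<open>For an edge \<open>e = {i, j}\<close> of the complete graph, \<open>Min e\<close> and \<open>Max e\<close> are its two
  endpoints; the cost matrix is symmetric, so their order does not matter.\<close>

definition tour_cost :: "real mat \<Rightarrow> nat set set \<Rightarrow> real"
  where "tour_cost C H = (\<Sum>e \<in> H. C $$ (Min e, Max e))"

definition tsp_opt :: "real mat \<Rightarrow> real"
  where "tsp_opt C = Min (tour_cost C ` hamiltonian_cycles (dim_row C))"

end

theory Submission
  imports Defs
begin

text \<open>Every tour crosses between the two halves of the vertex set at least twice, so it suffices
  to find a feasible point of value at most \<open>pi\<^sup>2 / n\<close>. Take \<open>X j\<close> constant off the diagonal
  within the two diagonal blocks, with value proportional to \<open>1 + cos (pi * j / d)\<close>, and constant
  on the off-diagonal blocks, with value proportional to \<open>1 - cos (pi * j / d)\<close> (both halved at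
  \<open>j = d\<close>). By orthogonality of the characters of the cycle of length \<open>2 * d\<close>, the
  \<open>k\<close>-th semidefinite constraint has vanishing block-constant part unless \<open>k = 1\<close>, where that
  part is a multiple of the square of the difference of the two block sums. The value of the
  point is \<open>d * (1 - cos (pi / d))\<close>, and \<open>1 - cos x \<le> x\<^sup>2 / 2\<close>.\<close>

section \<open>Trigonometric sums\<close>

lemma one_minus_cos_le: "1 - cos x \<le> x\<^sup>2 / 2" for x :: real
proof -
  have "cos x = 1 - 2 * (sin (x / 2))\<^sup>2"
    using cos_double_sin[of "x / 2"] by simp
  moreover have "(sin (x / 2))\<^sup>2 \<le> (x / 2)\<^sup>2"
    by (metis abs_sin_x_le_abs_x abs_le_square_iff)
  ultimately show ?thesis by (simp add: power_divide)
qed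

text \<open>Dirichlet kernel: multiplied by \<open>2 * sin (t / 2)\<close>, each cosine becomes a
  difference of sines at consecutive half-integer multiples of \<open>t\<close>.\<close>

lemma sum_cos_telescope:
  "2 * sin (t / 2) * (\<Sum>j=1..m. cos (real j * t)) = sin ((real m + 1 / 2) * t) - sin (t / 2)"
proof (induction m)
  case (Suc m)
  have "2 * sin (t / 2) * cos (real (Suc m) * t)
      = sin ((real (Suc m) + 1 / 2) * t) - sin ((real m + 1 / 2) * t)"
    using sin_add[of "real (Suc m) * t" "t / 2"] sin_diff[of "real (Suc m) * t" "t / 2"]
    by (simp add: algebra_simps add_divide_distrib)
  then show ?case using Suc by (simp add: distrib_left)
qed simp

text \<open>The antipodal class \<open>j = d\<close> of the cycle of length \<open>2 * d\<close> contains half as many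
  pairs as each of the others.\<close>

definition cycle_weight :: "nat \<Rightarrow> nat \<Rightarrow> real"
  where "cycle_weight d j = (if j = d then 1 / 2 else 1)"

text \<open>For \<open>d > 0\<close>, \<open>1 + 2 * cycle_sum d k\<close> is the sum of the
  \<open>k\<close>-th character over all residues modulo \<open>2 * d\<close>: \<open>j\<close> and
  \<open>2 * d - j\<close> contribute equally, and \<open>d\<close> is its own partner.\<close>

definition cycle_sum :: "nat \<Rightarrow> nat \<Rightarrow> real"
  where "cycle_sum d k = (\<Sum>j=1..d. cycle_weight d j * cos (real j * (pi * real k / real d)))"

lemma cycle_sum_split:
  assumes "0 < d"
  shows "cycle_sum d k = (\<Sum>j=1..d - 1. cos (real j * (pi * real k / real d))) + (-1) ^ k / 2"
proof -
  have "{1..d} = insert d {1..d - 1}" using assms by auto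
  then show ?thesis
    using assms unfolding cycle_sum_def
    by (auto simp: cycle_weight_def mult.commute intro!: sum.cong)
qed

lemma cycle_sum_0: "0 < d \<Longrightarrow> cycle_sum d 0 = real d - 1 / 2"
  by (subst cycle_sum_split) (auto simp: of_nat_diff)

text \<open>A nontrivial character sums to zero, and half of the missing term at residue 0 remains
  with a minus sign. The range of \<open>k\<close> puts \<open>t / 2\<close> strictly between 0 and
  \<open>pi\<close>, so that \<open>sin (t / 2)\<close> can be cancelled.\<close>

lemma cycle_sum_eq:
  assumes "0 < k" "k < 2 * d"
  shows "cycle_sum d k = - 1 / 2"
proof -
  define t where "t = pi * real k / real d"
  have d: "0 < d" using assms by simp
  have "0 < t / 2" "t / 2 < pi"
    using assms d by (auto simp: t_def field_simps)
  then have s: "sin (t / 2) > 0" by (rule sin_gt_zero)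
  \<comment> \<open>As \<open>d * t = k * pi\<close>, the last angle of the telescoped sum lies half
    a step before a multiple of \<open>pi\<close>.\<close>
  have "(real (d - 1) + 1 / 2) * t = real k * pi - t / 2"
    using d by (simp add: t_def of_nat_diff field_simps)
  then have "sin ((real (d - 1) + 1 / 2) * t) = - ((-1) ^ k * sin (t / 2))"
    by (simp add: sin_diff)
  then have "2 * sin (t / 2) * (\<Sum>j=1..d - 1. cos (real j * t))
      = 2 * sin (t / 2) * (- (1 + (-1) ^ k) / 2)"
    using sum_cos_telescope[of t "d - 1"] by (simp add: algebra_simps)
  then have "(\<Sum>j=1..d - 1. cos (real j * t)) = - (1 + (-1) ^ k) / 2"
    using s by (subst (asm) mult_cancel_left) auto
  then show ?thesis
    using cycle_sum_split[OF d, of k] by (simp add: t_def field_simps)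
qed

text \<open>Product-to-sum: a factor of frequency 1 moves frequency \<open>k\<close> to its two
  neighbours. With \<open>1 \<le> k\<close> the difference \<open>k - 1\<close> is not
  truncated.\<close>

lemma cycle_sum_mult_cos:
  assumes "1 \<le> k"
  shows "(\<Sum>j=1..d. cycle_weight d j * cos (real j * (pi / real d)) * cos (real j * (pi * real k / real d)))
      = (cycle_sum d (k + 1) + cycle_sum d (k - 1)) / 2"
proof -
  have "cos (real j * (pi / real d)) * cos (real j * (pi * real k / real d))
      = (cos (real j * (pi * real (k + 1) / real d)) + cos (real j * (pi * real (k - 1) / real d))) / 2" for j
  proof -
    have "real j * (pi * real (k + 1) / real d) = real j * (pi * real k / real d) + real j * (pi / real d)"
      "real j * (pi * real (k - 1) / real d) = real j * (pi * real k / real d) - real j * (pi / real d)"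
      using assms by (simp_all add: of_nat_diff algebra_simps add_divide_distrib diff_divide_distrib)
    then show ?thesis by (simp add: cos_add cos_diff)
  qed
  then show ?thesis
    unfolding cycle_sum_def sum.distrib[symmetric] sum_divide_distrib
    by (intro sum.cong refl) (simp only: mult.assoc distrib_left times_divide_eq_right)
qed

section \<open>Two-block matrices\<close>

text \<open>This family contains every matrix needed: the cost matrix, \<open>J - I\<close> and the
  feasible point with \<open>c = 0\<close>, the semidefinite constraints with
  \<open>c = 1\<close>.\<close>

definition two_block_mat :: "nat \<Rightarrow> real \<Rightarrow> real \<Rightarrow> real \<Rightarrow> real mat"
  where "two_block_mat d c a b = mat (2 * d) (2 * d)
    (\<lambda>(i, j). if i = j then c else if (i < d) = (j < d) then a else b)"

lemma two_block_mat_carrier [simp]: "two_block_mat d c a b \<in> carrier_mat (2 * d) (2 * d)"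
  and dim_two_block_mat [simp]: "dim_row (two_block_mat d c a b) = 2 * d"
    "dim_col (two_block_mat d c a b) = 2 * d"
  by (auto simp: two_block_mat_def)

lemma symmetric_two_block_mat: "symmetric_mat (two_block_mat d c a b)"
  unfolding symmetric_mat_def two_block_mat_def by (rule eq_matI) auto

lemma sum_two_blocks:
  "(\<Sum>i=0..<2 * d. f i) = (\<Sum>i=0..<d. f i) + (\<Sum>i=d..<2 * d. f i)" for f :: "nat \<Rightarrow> real"
  by (subst sum.atLeastLessThan_concat) auto

lemma two_block_mat_row:
  assumes "v \<in> carrier_vec (2 * d)" "i < 2 * d"
  shows "(two_block_mat d c a b *\<^sub>v v) $ i = (c - a) * v $ i
    + (if i < d then a else b) * (\<Sum>j=0..<d. v $ j)
    + (if i < d then b else a) * (\<Sum>j=d..<2 * d. v $ j)"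
proof -
  have "(two_block_mat d c a b *\<^sub>v v) $ i
      = (\<Sum>j=0..<2 * d. (if i = j then c else if (i < d) = (j < d) then a else b) * v $ j)"
    using assms by (auto simp: scalar_prod_def two_block_mat_def intro!: sum.cong)
  also have "\<dots> = (\<Sum>j=0..<2 * d. (if i = j then (c - a) * v $ j else 0)
      + (if (i < d) = (j < d) then a else b) * v $ j)"
    by (intro sum.cong) (auto simp: algebra_simps)
  also have "\<dots> = (c - a) * v $ i
      + (\<Sum>j=0..<2 * d. (if (i < d) = (j < d) then a else b) * v $ j)"
    using assms by (simp add: sum.distrib sum.delta')
  also have "(\<Sum>j=0..<2 * d. (if (i < d) = (j < d) then a else b) * v $ j)
      = (\<Sum>j=0..<d. (if i < d then a else b) * v $ j) + (\<Sum>j=d..<2 * d. (if i < d then b else a) * v $ j)"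
    unfolding sum_two_blocks by (intro arg_cong2[where f = "(+)"] sum.cong) auto
  finally show ?thesis by (simp add: sum_distrib_left)
qed

lemma two_block_mat_quadratic_form:
  assumes "v \<in> carrier_vec (2 * d)"
  defines "s \<equiv> \<Sum>j=0..<d. v $ j" and "t \<equiv> \<Sum>j=d..<2 * d. v $ j"
  shows "v \<bullet> (two_block_mat d c a b *\<^sub>v v)
    = (c - a) * ((\<Sum>j=0..<d. (v $ j)\<^sup>2) + (\<Sum>j=d..<2 * d. (v $ j)\<^sup>2)) + a * (s\<^sup>2 + t\<^sup>2) + 2 * b * s * t"
proof -
  have "v \<bullet> (two_block_mat d c a b *\<^sub>v v)
      = (\<Sum>i=0..<2 * d. v $ i * (two_block_mat d c a b *\<^sub>v v) $ i)"
    by (simp add: scalar_prod_def)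
  also have "\<dots> = (\<Sum>i=0..<d. (c - a) * (v $ i)\<^sup>2 + v $ i * (a * s + b * t))
      + (\<Sum>i=d..<2 * d. (c - a) * (v $ i)\<^sup>2 + v $ i * (b * s + a * t))"
    unfolding sum_two_blocks using assms(1)
    by (intro arg_cong2[where f = "(+)"] sum.cong)
      (auto simp: two_block_mat_row s_def t_def algebra_simps power2_eq_square
        simp del: index_mult_mat_vec)
  also have "\<dots> = (c - a) * ((\<Sum>j=0..<d. (v $ j)\<^sup>2) + (\<Sum>j=d..<2 * d. (v $ j)\<^sup>2))
      + s * (a * s + b * t) + t * (b * s + a * t)"
    unfolding sum.distrib sum_distrib_left[symmetric] sum_distrib_right[symmetric]
      s_def[symmetric] t_def[symmetric] by (simp add: algebra_simps)
  finally show ?thesis by (simp add: algebra_simps power2_eq_square)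
qed

text \<open>Nonnegativity of the variance: \<open>N * (N * (\<Sum>i\<in>A. (f i)^2) - s^2)\<close>
  is the sum of the squares of \<open>N * f i - s\<close>.\<close>

lemma square_sum_le_card_times_sum_squares:
  fixes f :: "'a \<Rightarrow> real"
  shows "(\<Sum>i\<in>A. f i)\<^sup>2 \<le> real (card A) * (\<Sum>i\<in>A. (f i)\<^sup>2)"
proof (cases "finite A \<and> A \<noteq> {}")
  case True
  define N where "N = real (card A)"
  define s where "s = (\<Sum>i\<in>A. f i)"
  have "N > 0" using True by (auto simp: N_def card_gt_0_iff)
  have "0 \<le> (\<Sum>i\<in>A. (N * f i - s)\<^sup>2)" by (intro sum_nonneg) auto
  also have "\<dots> = (\<Sum>i\<in>A. N\<^sup>2 * (f i)\<^sup>2 - 2 * N * s * f i + s\<^sup>2)"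
    by (intro sum.cong) (auto simp: power2_diff power_mult_distrib algebra_simps)
  also have "\<dots> = N * (N * (\<Sum>i\<in>A. (f i)\<^sup>2) - s\<^sup>2)"
    unfolding sum.distrib sum_subtractf sum_distrib_left[symmetric] s_def[symmetric]
    by (simp add: N_def[symmetric] power2_eq_square algebra_simps)
  finally show ?thesis using \<open>N > 0\<close> by (simp add: zero_le_mult_iff N_def s_def)
qed auto

text \<open>The eigenvalues are \<open>1 - a\<close> on vectors with both block sums zero and
  \<open>1 + (d - 1) * a + d * b\<close>, \<open>1 + (d - 1) * a - d * b\<close> on block-constant
  vectors; the hypotheses make them nonnegative.\<close>

lemma psd_two_block_mat:
  assumes "0 < d" "a \<le> 1" "real d * \<bar>b\<bar> \<le> 1 + (real d - 1) * a"
  shows "psd_mat (two_block_mat d 1 a b)"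
  unfolding psd_mat_def
proof (intro conjI ballI)
  fix v :: "real vec"
  assume "v \<in> carrier_vec (dim_row (two_block_mat d 1 a b))"
  then have v: "v \<in> carrier_vec (2 * d)" by simp
  define s where "s = (\<Sum>j=0..<d. v $ j)"
  define t where "t = (\<Sum>j=d..<2 * d. v $ j)"
  define p where "p = (\<Sum>j=0..<d. (v $ j)\<^sup>2)"
  define q where "q = (\<Sum>j=d..<2 * d. (v $ j)\<^sup>2)"
  have "s\<^sup>2 + t\<^sup>2 \<le> real d * (p + q)"
    using square_sum_le_card_times_sum_squares[of "\<lambda>j. v $ j" "{0..<d}"]
      square_sum_le_card_times_sum_squares[of "\<lambda>j. v $ j" "{d..<2 * d}"]
    by (simp add: s_def t_def p_def q_def algebra_simps)
  then have "(1 - a) * (s\<^sup>2 + t\<^sup>2) \<le> (1 - a) * (real d * (p + q))"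
    using assms by (intro mult_left_mono) auto
  moreover have "real d * \<bar>b\<bar> * (s\<^sup>2 + t\<^sup>2) \<le> (1 + (real d - 1) * a) * (s\<^sup>2 + t\<^sup>2)"
    using assms by (intro mult_right_mono) auto
  moreover have "real d * (- (2 * b * s * t)) \<le> real d * (\<bar>b\<bar> * (s\<^sup>2 + t\<^sup>2))"
  proof (intro mult_left_mono)
    have "- (2 * b * s * t) \<le> \<bar>2 * b * s * t\<bar>" by simp
    also have "\<dots> = \<bar>b\<bar> * (2 * \<bar>s\<bar> * \<bar>t\<bar>)" by (simp add: abs_mult)
    also have "\<dots> \<le> \<bar>b\<bar> * (s\<^sup>2 + t\<^sup>2)"
      using sum_squares_bound[of "\<bar>s\<bar>" "\<bar>t\<bar>"] by (intro mult_left_mono) auto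
    finally show "- (2 * b * s * t) \<le> \<bar>b\<bar> * (s\<^sup>2 + t\<^sup>2)" .
  qed simp
  \<comment> \<open>The three estimates bound this below by
    \<open>(1 + (d - 1) * a - d * \<bar>b\<bar>) * (s^2 + t^2)\<close>.\<close>
  ultimately have "0 \<le> real d * ((1 - a) * (p + q) + a * (s\<^sup>2 + t\<^sup>2) + 2 * b * s * t)"
    by (simp add: algebra_simps)
  then have "0 \<le> (1 - a) * (p + q) + a * (s\<^sup>2 + t\<^sup>2) + 2 * b * s * t"
    using assms(1) by (simp add: zero_le_mult_iff)
  then show "0 \<le> v \<bullet> (two_block_mat d 1 a b *\<^sub>v v)"
    using two_block_mat_quadratic_form[OF v, of 1 a b] by (simp add: s_def t_def p_def q_def)
qed (rule symmetric_two_block_mat)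

lemma finsum_two_block_mat:
  assumes "finite F"
  shows "(\<Oplus>\<^bsub>module_mat TYPE(real) (2 * d) (2 * d)\<^esub> j \<in> F. r j \<cdot>\<^sub>m two_block_mat d 0 (a j) (b j))
    = two_block_mat d 0 (\<Sum>j\<in>F. r j * a j) (\<Sum>j\<in>F. r j * b j)"
proof -
  interpret abelian_group "module_mat TYPE(real) (2 * d) (2 * d)" by (rule abelian_group_mat)
  show ?thesis
    using assms
  proof (induction F rule: finite_induct)
    case empty
    show ?case
      by (simp add: module_mat_simps) (rule eq_matI, auto simp: two_block_mat_def)
  next
    case (insert j F)
    show ?case
      by (subst finsum_insert)
        (use insert in \<open>auto simp: module_mat_simps intro!: eq_matI\<close>,
          auto simp: two_block_mat_def)
  qed
qed

section \<open>A feasible point of small cost\<close>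

text \<open>A row has \<open>d - 1\<close> off-diagonal entries in its own block and
  \<open>d\<close> in the other. Dividing by these counts gives the \<open>j\<close>-th matrix of
  the point row sums \<open>2 * cycle_weight d j\<close>, the degree of the
  distance-\<open>j\<close> graph of the cycle.\<close>

definition within_weight :: "nat \<Rightarrow> nat \<Rightarrow> real"
  where "within_weight d j = cycle_weight d j * (1 + cos (real j * (pi / real d))) / (real d - 1)"

definition across_weight :: "nat \<Rightarrow> nat \<Rightarrow> real"
  where "across_weight d j = cycle_weight d j * (1 - cos (real j * (pi / real d))) / real d"

definition sdp_point :: "nat \<Rightarrow> nat \<Rightarrow> real mat"
  where "sdp_point d j = two_block_mat d 0 (within_weight d j) (across_weight d j)"

lemma sum_weights_cos:
  assumes "1 \<le> k"
  shows "(\<Sum>j=1..d. cos (real j * (pi * real k / real d)) * within_weight d j)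
      = (cycle_sum d k + (cycle_sum d (k + 1) + cycle_sum d (k - 1)) / 2) / (real d - 1)"
    and "(\<Sum>j=1..d. cos (real j * (pi * real k / real d)) * across_weight d j)
      = (cycle_sum d k - (cycle_sum d (k + 1) + cycle_sum d (k - 1)) / 2) / real d"
  unfolding cycle_sum_mult_cos[OF assms, symmetric] cycle_sum_def[of d k]
    within_weight_def across_weight_def
  unfolding sum.distrib[symmetric] sum_subtractf[symmetric] sum_divide_distrib
  by (auto intro!: sum.cong simp: algebra_simps)

text \<open>The case of frequency 0, which \<open>sum_weights_cos\<close> excludes because of its
  \<open>k - 1\<close>.\<close>

lemma sum_weights:
  assumes "2 \<le> d"
  shows "(\<Sum>j=1..d. within_weight d j) = 1" "(\<Sum>j=1..d. across_weight d j) = 1"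
proof -
  have "(\<Sum>j=1..d. within_weight d j) = (cycle_sum d 0 + cycle_sum d 1) / (real d - 1)"
    "(\<Sum>j=1..d. across_weight d j) = (cycle_sum d 0 - cycle_sum d 1) / real d"
    unfolding cycle_sum_def within_weight_def across_weight_def
    unfolding sum.distrib[symmetric] sum_subtractf[symmetric] sum_divide_distrib
    by (auto intro!: sum.cong simp: algebra_simps)
  moreover have "cycle_sum d 0 = real d - 1 / 2" "cycle_sum d 1 = - 1 / 2"
    using assms by (auto simp: cycle_sum_0 cycle_sum_eq)
  ultimately show "(\<Sum>j=1..d. within_weight d j) = 1" "(\<Sum>j=1..d. across_weight d j) = 1"
    using assms by auto
qed

lemma psd_sdp_point:
  assumes "2 \<le> d" "1 \<le> k" "k \<le> d"
  shows "psd_mat (two_block_mat d 1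
    (\<Sum>j=1..d. cos (real j * (pi * real k / real d)) * within_weight d j)
    (\<Sum>j=1..d. cos (real j * (pi * real k / real d)) * across_weight d j))"
proof (cases "k = 1")
  case True
  have "cycle_sum d 1 = - 1 / 2" "cycle_sum d 2 = - 1 / 2" "cycle_sum d 0 = real d - 1 / 2"
    using assms by (auto simp: cycle_sum_0 cycle_sum_eq)
  then have "(\<Sum>j=1..d. cos (real j * (pi * real k / real d)) * within_weight d j)
      = (real d - 2) / (2 * (real d - 1))"
    "(\<Sum>j=1..d. cos (real j * (pi * real k / real d)) * across_weight d j) = - 1 / 2"
    using assms True unfolding sum_weights_cos[OF assms(2)] by (auto simp: field_simps numeral_2_eq_2)
  note eqs = this
  \<comment> \<open>The third condition of \<open>psd_two_block_mat\<close> is tight: both sides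
    equal \<open>d / 2\<close>.\<close>
  show ?thesis
    unfolding eqs by (rule psd_two_block_mat) (use assms in \<open>auto simp: field_simps\<close>)
next
  case False
  \<comment> \<open>For \<open>2 \<le> k \<le> d\<close> all three frequencies lie strictly between
    0 and \<open>2 * d\<close>.\<close>
  then have "cycle_sum d k = - 1 / 2" "cycle_sum d (k + 1) = - 1 / 2" "cycle_sum d (k - 1) = - 1 / 2"
    using assms by - (rule cycle_sum_eq; linarith)+
  then have "(\<Sum>j=1..d. cos (real j * (pi * real k / real d)) * within_weight d j) = - 1 / (real d - 1)"
    "(\<Sum>j=1..d. cos (real j * (pi * real k / real d)) * across_weight d j) = 0"
    unfolding sum_weights_cos[OF assms(2)] by auto
  note eqs = this
  show ?thesis
    unfolding eqs by (rule psd_two_block_mat) (use assms in \<open>auto simp: field_simps\<close>)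
qed

lemma sdp_point_feasible:
  assumes "2 \<le> d"
  shows "sdp_point d \<in> sdp_feasible (2 * d)"
proof -
  let ?M = "module_mat TYPE(real) (2 * d) (2 * d)"
  have nonneg: "0 \<le> within_weight d j" "0 \<le> across_weight d j" for j
    using assms cos_ge_minus_one[of "real j * (pi / real d)"]
    by (auto simp: within_weight_def across_weight_def cycle_weight_def
        intro!: divide_nonneg_nonneg simp del: cos_ge_minus_one)
  have "sdp_point d k \<in> carrier_mat (2 * d) (2 * d)" "symmetric_mat (sdp_point d k)" for k
    by (simp_all add: sdp_point_def symmetric_two_block_mat)
  moreover have "0\<^sub>m (2 * d) (2 * d) \<le> sdp_point d k" for k
    using nonneg by (auto simp: less_eq_mat_def sdp_point_def two_block_mat_def)
  moreover have "(\<Oplus>\<^bsub>?M\<^esub> j \<in> {1..d}. sdp_point d j) = J\<^sub>m (2 * d) - 1\<^sub>m (2 * d)"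
  proof -
    have "1 \<cdot>\<^sub>m two_block_mat d 0 a b = two_block_mat d 0 a b" for a b
      by (rule eq_matI) auto
    then have "(\<Oplus>\<^bsub>?M\<^esub> j \<in> {1..d}. sdp_point d j) = two_block_mat d 0 1 1"
      using finsum_two_block_mat[of "{1..d}" d "\<lambda>_. 1" "within_weight d" "across_weight d"]
        sum_weights[OF assms] by (simp add: sdp_point_def)
    also have "\<dots> = J\<^sub>m (2 * d) - 1\<^sub>m (2 * d)"
      by (rule eq_matI) (auto simp: two_block_mat_def all_ones_mat_def)
    finally show ?thesis .
  qed
  moreover have "psd_mat (1\<^sub>m (2 * d) + (\<Oplus>\<^bsub>?M\<^esub> j \<in> {1..d}.
      cos (2 * pi * real j * real k / real (2 * d)) \<cdot>\<^sub>m sdp_point d j))" if "k \<in> {1..d}" for k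
  proof -
    have "2 * pi * real j * real k / real (2 * d) = real j * (pi * real k / real d)" for j
      by (simp add: field_simps)
    moreover have "1\<^sub>m (2 * d) + two_block_mat d 0 a b = two_block_mat d 1 a b" for a b
      by (rule eq_matI) (auto simp: two_block_mat_def)
    ultimately show ?thesis
      using psd_sdp_point[OF assms, of k] that
      by (simp only: sdp_point_def finsum_two_block_mat finite_atLeastAtMost atLeastAtMost_iff)
  qed
  ultimately show ?thesis
    unfolding sdp_feasible_def by simp
qed

section \<open>The cost matrix\<close>

lemma cost_mat_eq_two_block_mat:
  "mat_of_rows_list 2 [[0, 1], [1, 0]] \<otimes>\<^sub>m J\<^sub>m d = two_block_mat d 0 0 1"
proof (rule eq_matI)
  fix i j assume "i < dim_row (two_block_mat d 0 0 1)" "j < dim_col (two_block_mat d 0 0 1)"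
  then have ij: "i < 2 * d" "j < 2 * d" by auto
  have div_block: "m div d = (if m < d then 0 else 1)" if "m < 2 * d" for m
    using that by (auto intro: div_nat_eqI)
  have "0 < d" using ij by auto
  with ij show "(mat_of_rows_list 2 [[0, 1], [1, 0]] \<otimes>\<^sub>m J\<^sub>m d) $$ (i, j) = two_block_mat d 0 0 1 $$ (i, j)"
    by (auto simp: kronecker_mat_def mat_of_rows_list_def all_ones_mat_def two_block_mat_def div_block)
qed (auto simp: kronecker_mat_def mat_of_rows_list_def all_ones_mat_def)

lemma trace_mult_two_block_mat:
  assumes "X \<in> carrier_mat (2 * d) (2 * d)"
  shows "trace_mat (two_block_mat d 0 0 1 * X)
    = (\<Sum>i<2 * d. \<Sum>j=0..<2 * d. if (i < d) = (j < d) then 0 else X $$ (j, i))"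
  unfolding trace_mat_def using assms
  by (auto simp: scalar_prod_def two_block_mat_def intro!: sum.cong)

lemma sdp_opt_le:
  assumes "2 \<le> d"
  shows "sdp_opt (two_block_mat d 0 0 1) \<le> (real d)\<^sup>2 * across_weight d 1"
proof -
  let ?C = "two_block_mat d 0 0 1"
  \<comment> \<open>A real infimum is a lower bound only for a set bounded below; here 0 is a bound,
    as all entries are nonnegative.\<close>
  have "bdd_below ((\<lambda>X. 1 / 2 * trace_mat (?C * X 1)) ` sdp_feasible (2 * d))"
  proof (rule bdd_belowI2)
    fix X assume "X \<in> sdp_feasible (2 * d)"
    then have "X 1 \<in> carrier_mat (2 * d) (2 * d)" "0\<^sub>m (2 * d) (2 * d) \<le> X 1"
      using assms by (auto simp: sdp_feasible_def)
    then show "0 \<le> 1 / 2 * trace_mat (?C * X 1)"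
      by (auto simp: trace_mult_two_block_mat less_eq_mat_def intro!: sum_nonneg)
  qed
  then have "sdp_opt ?C \<le> 1 / 2 * trace_mat (?C * sdp_point d 1)"
    unfolding sdp_opt_def dim_two_block_mat by (rule cINF_lower) (rule sdp_point_feasible[OF assms])
  also have "trace_mat (?C * sdp_point d 1) = 2 * (real d)\<^sup>2 * across_weight d 1"
  proof -
    have "trace_mat (?C * sdp_point d 1)
        = (\<Sum>i<2 * d. \<Sum>j=0..<2 * d. if (i < d) = (j < d) then 0 else across_weight d 1)"
      by (subst trace_mult_two_block_mat)
        (auto simp: sdp_point_def two_block_mat_def intro!: sum.cong)
    \<comment> \<open>Each index \<open>i\<close> meets the opposite block in exactly
      \<open>d\<close> entries.\<close>
    also have "\<dots> = (\<Sum>i<2 * d. real d * across_weight d 1)"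
    proof (intro sum.cong refl)
      fix i
      have "(\<Sum>j=0..<2 * d. if (i < d) = (j < d) then 0 else across_weight d 1)
          = (\<Sum>j=0..<d. if i < d then 0 else across_weight d 1)
            + (\<Sum>j=d..<2 * d. if i < d then across_weight d 1 else 0)"
        unfolding sum_two_blocks by (intro arg_cong2[where f = "(+)"] sum.cong) auto
      then show "(\<Sum>j=0..<2 * d. if (i < d) = (j < d) then 0 else across_weight d 1)
          = real d * across_weight d 1"
        by (simp split: if_splits)
    qed
    finally show ?thesis by (simp add: power2_eq_square)
  qed
  finally show ?thesis by simp
qed

section \<open>Tours\<close>

text \<open>Otherwise \<open>P\<close> would spread from \<open>a\<close> along successors around
  the whole cycle.\<close>

lemma cyclic_exit:
  assumes "a < n" "P a" "b < n" "\<not> P b"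
  shows "\<exists>i<n. P i \<and> \<not> P (Suc i mod n)"
proof (rule ccontr)
  assume "\<not> ?thesis"
  then have step: "P (Suc i mod n)" if "i < n" "P i" for i
    using that by blast
  have "P ((a + m) mod n)" for m
  proof (induction m)
    case (Suc m)
    have "Suc ((a + m) mod n) mod n = (a + Suc m) mod n" by (simp add: mod_Suc_eq)
    then show ?case using step[of "(a + m) mod n"] Suc assms by simp
  qed (use assms in simp)
  \<comment> \<open>Adding \<open>n\<close> gives a number of steps from \<open>a\<close> to
    \<open>b\<close> also when \<open>b < a\<close>.\<close>
  from this[of "n - a + b"] show False using assms by simp
qed

text \<open>The tour must leave the first half and come back, and each of these two edges costs
  1.\<close>

lemma tour_cost_ge_2:
  assumes d: "2 \<le> d" and "H \<in> hamiltonian_cycles (2 * d)"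
  shows "2 \<le> tour_cost (two_block_mat d 0 0 1) H"
proof -
  define n where "n = 2 * d"
  obtain p where p: "bij_betw p {0..<n} {0..<n}"
    and H: "H = (\<lambda>i. {p i, p (Suc i mod n)}) ` {0..<n}"
    using assms by (auto simp: hamiltonian_cycles_def n_def)
  have n: "n \<ge> 4" using d by (simp add: n_def)
  have inj: "p i = p j \<longleftrightarrow> i = j" if "i < n" "j < n" for i j
    using bij_betw_imp_inj_on[OF p] that by (auto simp: inj_on_def)
  have range: "p i < n" if "i < n" for i using bij_betwE[OF p] that by auto
  obtain x where x: "x < n" "p x = 0"
    using bij_betw_imp_surj_on[OF p] n by (metis (no_types, lifting) atLeastLessThan_iff imageE
        le0 less_le_trans zero_less_numeral)
  obtain y where y: "y < n" "p y = d"
  proof -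
    have "d \<in> p ` {0..<n}" using bij_betw_imp_surj_on[OF p] d by (simp add: n_def)
    then show ?thesis using that by auto
  qed
  obtain i where i: "i < n" "p i < d" "\<not> p (Suc i mod n) < d"
    using cyclic_exit[of x n "\<lambda>i. p i < d" y] x y d by auto
  obtain j where j: "j < n" "\<not> p j < d" "p (Suc j mod n) < d"
    using cyclic_exit[of y n "\<lambda>i. \<not> p i < d" x] x y d by auto
  let ?cost = "\<lambda>e. two_block_mat d 0 0 1 $$ (Min e, Max e)"
  let ?e = "\<lambda>i. {p i, p (Suc i mod n)}"
  \<comment> \<open>A tour is a set of edges, so the two crossings might coincide. Then
    \<open>i\<close> and \<open>j\<close> would be successors of each other, impossible in a cycle
    of length at least 4.\<close>
  have "?e i \<noteq> ?e j"
  proof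
    assume "?e i = ?e j"
    then have "p i = p (Suc j mod n)" "p j = p (Suc i mod n)"
      using i j by (auto simp: doubleton_eq_iff)
    then have "i = Suc j mod n" "j = Suc i mod n" using i j n by (auto simp: inj)
    moreover have "Suc k mod n = (if Suc k = n then 0 else Suc k)" if "k < n" for k
      using that by auto
    ultimately show False using i j n by (auto split: if_splits)
  qed
  have cost: "?cost {k, l} = (if (k < d) = (l < d) then 0 else 1)" if "k < n" "l < n" for k l
    using that by (auto simp: two_block_mat_def n_def min_def max_def)
  have "2 = (\<Sum>e\<in>{?e i, ?e j}. ?cost e)"
    using \<open>?e i \<noteq> ?e j\<close> i j n
    by (subst sum.insert) (simp_all add: cost range del: Min_insert Max_insert)
  also have "\<dots> \<le> (\<Sum>e\<in>H. ?cost e)"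
  proof (rule sum_mono2)
    have "?e k \<in> H" if "k < n" for k
      unfolding H using that by (intro imageI) simp
    then show "{?e i, ?e j} \<subseteq> H" using i(1) j(1) by (intro insert_subsetI) simp_all
    fix e assume "e \<in> H - {?e i, ?e j}"
    then obtain k where "k < n" "e = ?e k" unfolding H by fastforce
    then show "0 \<le> ?cost e"
      using cost[of "p k" "p (Suc k mod n)"] range n by simp
  qed (simp add: H)
  finally show ?thesis by (simp add: tour_cost_def)
qed

lemma tsp_opt_ge_2:
  assumes "2 \<le> d"
  shows "2 \<le> tsp_opt (two_block_mat d 0 0 1)"
proof -
  \<comment> \<open>\<open>Min\<close> is only meaningful on a finite nonempty set.\<close>
  have "hamiltonian_cycles (2 * d) \<subseteq> Pow (Pow {0..<2 * d})"
  proof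
    fix H assume "H \<in> hamiltonian_cycles (2 * d)"
    then obtain p where "bij_betw p {0..<2 * d} {0..<2 * d}"
      "H = (\<lambda>i. {p i, p (Suc i mod (2 * d))}) ` {0..<2 * d}"
      by (auto simp: hamiltonian_cycles_def)
    then show "H \<in> Pow (Pow {0..<2 * d})"
      using bij_betwE[of p] assms by fastforce
  qed
  then have "finite (hamiltonian_cycles (2 * d))" by (rule finite_subset) auto
  moreover have "hamiltonian_cycles (2 * d) \<noteq> {}"
    unfolding hamiltonian_cycles_def using bij_betw_id by blast
  ultimately show ?thesis
    unfolding tsp_opt_def using tour_cost_ge_2[OF assms] by simp
qed

theorem theorem1:
  fixes n d :: nat and C :: "real mat"
  assumes "n \<ge> 4" and "even n" and "d = n div 2"
    and "C = mat_of_rows_list 2 [[0, 1], [1, 0]] \<otimes>\<^sub>m J\<^sub>m d"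
  shows "sdp_opt C \<le> pi\<^sup>2 / (2 * real n) * tsp_opt C"
proof -
  have d: "2 \<le> d" and n: "n = 2 * d" using assms by auto
  have C: "C = two_block_mat d 0 0 1" using assms(4) cost_mat_eq_two_block_mat by simp
  have "sdp_opt C \<le> (real d)\<^sup>2 * across_weight d 1"
    unfolding C by (rule sdp_opt_le[OF d])
  also have "\<dots> = real d * (1 - cos (pi / real d))"
    using d by (simp add: across_weight_def cycle_weight_def power2_eq_square)
  also have "\<dots> \<le> real d * ((pi / real d)\<^sup>2 / 2)"
    by (intro mult_left_mono one_minus_cos_le) simp
  \<comment> \<open>The factor 2 is split off to be replaced by the tour bound.\<close>
  also have "\<dots> = pi\<^sup>2 / (2 * real n) * 2"
    using d by (simp add: n power2_eq_square field_simps)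
  also have "\<dots> \<le> pi\<^sup>2 / (2 * real n) * tsp_opt C"
    unfolding C by (intro mult_left_mono tsp_opt_ge_2[OF d]) simp
  finally show ?thesis .
qed

end
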